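(* Let $\mathcal{A}:\mathbb{R}^{m\times n}\to\mathbb{R}^p$ be a linear map and suppose that $b=\mathcal{A}X_r+e$, where $X_r\in\mathbb{R}^{m\times n}$ is a rank-$r$ matrix and $e\in\mathbb{R}^p$. Suppose $\mathcal{A}$ has the restricted isometry property with $\delta_{3r}(\mathcal{A})\le\alpha/\sqrt{8}$, where $\alpha\in(0,1)$. Consider the algorithm FPCAr (defined in the context) with data $\mathcal{A},b,r$, initial matrix $X^0$ and parameters $\mu_1>\mu_2>\cdots>\mu_L=\bar\mu$, and suppose that in FPCAr, after $K_j$ iterations with fixed $\mu=\mu_j$, we obtain a solution $X_{(j)}^{(K_j)}$ that is then set to the initial point $X_{(j+1)}^0$ for the next continuation subproblem $\mu=\mu_{j+1}$. Then FPCAr will recover an approximation $X_{(L)}^{(K_L)}$ that satisfies $$\left\|X_r-X_{(L)}^{(K_L)}\right\|_F\le\left(\alpha^{\sum_{j=1}^LK_j}\right)\|X_r-X^0\|_F+\left(\sum_{j=2}^L\alpha^{\sum_{l=j}^LK_l}+1\right)\frac{\beta}{1-\alpha}\|e\|_2+\left(\sum_{j=2}^L\left(\alpha^{\sum_{l=j}^LK_l}\right)\mu_{j-1}+\mu_L\right)\frac{2\sqrt{m}}{1-\alpha},$$ where $\beta:=2\sqrt{1+\alpha/\sqrt{8}}$.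
   Context: Throughout $m\le n$. $\|\cdot\|_F$ is the Frobenius norm on $\mathbb{R}^{m\times n}$ (with inner product $\langle X,Y\rangle=\mathrm{Tr}(X^\top Y)$), $\|\cdot\|_2$ is the Euclidean norm on $\mathbb{R}^p$, and $\mathcal{A}^*:\mathbb{R}^p\to\mathbb{R}^{m\times n}$ is the adjoint of $\mathcal{A}$. $\mathcal{A}X$ means $\mathcal{A}(X)$. Restricted isometry constant: for an integer $s$ with $1\le s\le m$, $\delta_s(\mathcal{A})$ is the minimum constant such that $(1-\delta_s(\mathcal{A}))\|X\|_F^2\le\|\mathcal{A}X\|_2^2\le(1+\delta_s(\mathcal{A}))\|X\|_F^2$ for all $X\in\mathbb{R}^{m\times n}$ with $\mathrm{rank}(X)\le s$. Best rank-$r$ approximation (hard thresholding): if $X=\sum_{i=1}^m\sigma_iu_iv_i^\top$ is the singular value decomposition of $X$ with $\sigma_1\ge\cdots\ge\sigma_m$, then $R_r(X)=\sum_{i=1}^r\sigma_iu_iv_i^\top$. Matrix shrinkage operator (soft thresholding): if $X=U\,\mathrm{Diag}(\sigma)V^\top$ is the singular value decomposition of $X$ and $\nu>0$, then $S_\nu(X)=U\,\mathrm{Diag}((\sigma-\nu)_+)V^\top$, where $a_+:=\max(a,0)$ is applied componentwise. Algorithm FPCAr (fixed-point continuation with given rank $r$ and unit stepsize): the input is an initial matrix $X^0=X_{(1)}^0\in\mathbb{R}^{m\times n}$, the rank $r$, and $\mu_1>\mu_2>\cdots>\mu_L=\bar\mu>0$ (consecutive values are related by $\mu_{j+1}=\max\{\mu_j\eta_\mu,\bar\mu\}$,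 where the parameter $\eta_\mu$ determines the rate of reduction). For $j=1,\ldots,L$: set $\mu=\mu_j$; for $k=0,1,\ldots,K_j-1$ set $Y_{(j)}^{k+1}:=X_{(j)}^k-\mathcal{A}^*(\mathcal{A}X_{(j)}^k-b)$ and $X_{(j)}^{k+1}:=S_\mu(R_r(Y_{(j)}^{k+1}))$; the $K_j$-th iterate is denoted $X_{(j)}^{(K_j)}$, and $X_{(j+1)}^0:=X_{(j)}^{(K_j)}$.
   Formalization: The initial matrix X^0 is additionally assumed to have rank at most r (for example X^0 = 0); for an arbitrary initial matrix X^0 the claimed bound is false. *)

theory Defs
  imports "HOL-Analysis.Analysis"
begin

text \<open>
  An $m \times n$ real matrix is an element of \<^typ>\<open>real^'n^'m\<close>, with $m$ = \<^term>\<open>CARD('m)\<close> and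
  $n$ = \<^term>\<open>CARD('n)\<close>.  The library inner product on this type is the sum of the products of
  corresponding entries, that is $\mathrm{Tr}(X^T Y)$; hence \<^const>\<open>norm\<close> is the Frobenius norm
  and \<^const>\<open>adjoint\<close> is the adjoint for the Frobenius inner product.  (The operator norm would
  be \<open>onorm\<close>.)
\<close>

definition ric :: "(real^'n^'m \<Rightarrow> real^'p) \<Rightarrow> nat \<Rightarrow> real" where
  "ric \<A> s = (LEAST \<delta>. \<forall>X. rank X \<le> s \<longrightarrow>
      (1 - \<delta>) * (norm X)\<^sup>2 \<le> (norm (\<A> X))\<^sup>2 \<and>
      (norm (\<A> X))\<^sup>2 \<le> (1 + \<delta>) * (norm X)\<^sup>2)"

definition outer_prod :: "real^'m \<Rightarrow> real^'n \<Rightarrow> real^'n^'m" where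
  "outer_prod u v = (\<chi> i j. u $ i * v $ j)"

definition orthonormal_upto :: "nat \<Rightarrow> (nat \<Rightarrow> 'a::real_inner) \<Rightarrow> bool" where
  "orthonormal_upto k u \<longleftrightarrow>
     (\<forall>i\<in>{1..k}. \<forall>j\<in>{1..k}. u i \<bullet> u j = (if i = j then 1 else 0))"

text \<open>
  Thin singular value decomposition of an $m \times n$ matrix with $m$ singular triples,
  meaningful for $m \le n$.  Only the indices $1, \dots, m$ of the sequences matter.
\<close>

definition is_svd ::
    "real^'n^'m \<Rightarrow> (nat \<Rightarrow> real) \<Rightarrow> (nat \<Rightarrow> real^'m) \<Rightarrow> (nat \<Rightarrow> real^'n) \<Rightarrow> bool" where
  "is_svd X \<sigma> u v \<longleftrightarrow>
     orthonormal_upto CARD('m) u \<and> orthonormal_upto CARD('m) v \<and>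
     (\<forall>i\<in>{1..CARD('m)}. 0 \<le> \<sigma> i) \<and>
     (\<forall>i\<in>{1..CARD('m)}. \<forall>j\<in>{1..CARD('m)}. i \<le> j \<longrightarrow> \<sigma> j \<le> \<sigma> i) \<and>
     X = (\<Sum>i=1..CARD('m). \<sigma> i *\<^sub>R outer_prod (u i) (v i))"

text \<open>
  Hard and soft thresholding are given by their graphs.  The value $R_r(X)$ depends on the chosen
  singular value decomposition when $\sigma_r = \sigma_{r+1}$; the relation admits every choice.
  The value $S_\nu(X)$ does not depend on the decomposition.
\<close>

definition hard_threshold :: "nat \<Rightarrow> real^'n^'m \<Rightarrow> real^'n^'m \<Rightarrow> bool" where
  "hard_threshold r X Z \<longleftrightarrow>
     (\<exists>\<sigma> u v. is_svd X \<sigma> u v \<and> Z = (\<Sum>i=1..r. \<sigma> i *\<^sub>R outer_prod (u i) (v i)))"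

definition soft_threshold :: "real \<Rightarrow> real^'n^'m \<Rightarrow> real^'n^'m \<Rightarrow> bool" where
  "soft_threshold \<nu> X Z \<longleftrightarrow>
     (\<exists>\<sigma> u v. is_svd X \<sigma> u v \<and>
        Z = (\<Sum>i=1..CARD('m). max (\<sigma> i - \<nu>) 0 *\<^sub>R outer_prod (u i) (v i)))"

definition continuation_schedule :: "real \<Rightarrow> real \<Rightarrow> nat \<Rightarrow> (nat \<Rightarrow> real) \<Rightarrow> bool" where
  "continuation_schedule \<eta> \<mu>bar L \<mu> \<longleftrightarrow>
     1 \<le> L \<and> 0 < \<mu>bar \<and> \<mu> L = \<mu>bar \<and>
     (\<forall>j\<in>{1..<L}. \<mu> (Suc j) < \<mu> j \<and> \<mu> (Suc j) = max (\<mu> j * \<eta>) \<mu>bar)"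

text \<open>
  \<open>FPCAr_run \<A> b r L \<mu> K X0 X\<close>: the family \<open>X j k\<close> (continuation stage \<open>j\<close>, inner
  iterate \<open>k\<close>) is a run of FPCAr started at \<open>X0\<close>, with \<open>K j\<close> inner iterations in stage \<open>j\<close>.
\<close>

definition FPCAr_run ::
    "(real^'n^'m \<Rightarrow> real^'p) \<Rightarrow> real^'p \<Rightarrow> nat \<Rightarrow> nat \<Rightarrow> (nat \<Rightarrow> real) \<Rightarrow> (nat \<Rightarrow> nat) \<Rightarrow>
     real^'n^'m \<Rightarrow> (nat \<Rightarrow> nat \<Rightarrow> real^'n^'m) \<Rightarrow> bool" where
  "FPCAr_run \<A> b r L \<mu> K X0 X \<longleftrightarrow>
     X 1 0 = X0 \<and>
     (\<forall>j\<in>{1..L}. \<forall>k<K j. \<exists>Y W.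
        Y = X j k - adjoint \<A> (\<A> (X j k) - b) \<and>
        hard_threshold r Y W \<and>
        soft_threshold (\<mu> j) W (X j (Suc k))) \<and>
     (\<forall>j\<in>{1..<L}. X (Suc j) 0 = X j (K j))"

end

theory Submission
  imports Defs
begin

text \<open>
  One step maps \<open>X\<close> to \<open>S\<^sub>\<mu>(W)\<close> with \<open>W = R\<^sub>r(Y)\<close>. Since \<open>W\<close> is a best rank-\<open>r\<close> approximation of
  \<open>Y\<close> (Eckart--Young, which follows from Bessel's inequality), it is at least as close to \<open>Y\<close> as \<open>X\<^sub>r\<close>,
  which amounts to \<open>\<parallel>X\<^sub>r - W\<parallel>\<^sup>2 \<le> 2 \<langle>Y - X\<^sub>r, W - X\<^sub>r\<rangle>\<close>. Here
  \<open>Y - X\<^sub>r = (I - A\<^sup>*A)(X - X\<^sub>r) + A\<^sup>*e\<close>, and the combinations of \<open>X, X\<^sub>r, W\<close> have rank at most \<open>3r\<close>,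
  so polarising the restricted isometry property gives
  \<open>\<parallel>X\<^sub>r - W\<parallel> \<le> 2\<delta> \<parallel>X\<^sub>r - X\<parallel> + 2 sqrt (1 + \<delta>) \<parallel>e\<parallel>\<close>. Soft thresholding does not increase the rank
  and moves \<open>W\<close> by at most \<open>\<mu> sqrt m\<close>. The resulting affine contraction is iterated first
  within a stage and then over the stages.
\<close>

section \<open>Orthonormal families\<close>

lemma norm_sum_orthonormal:
  fixes u :: "'i \<Rightarrow> 'a::real_inner"
  assumes "finite I" and on: "\<And>i j. i \<in> I \<Longrightarrow> j \<in> I \<Longrightarrow> u i \<bullet> u j = (if i = j then 1 else 0)"
  shows "(norm (\<Sum>i\<in>I. a i *\<^sub>R u i))\<^sup>2 = (\<Sum>i\<in>I. (a i)\<^sup>2)"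
proof -
  have "(norm (\<Sum>i\<in>I. a i *\<^sub>R u i))\<^sup>2 = (\<Sum>i\<in>I. \<Sum>j\<in>I. a i * (a j * (u j \<bullet> u i)))"
    by (simp add: power2_norm_eq_inner inner_sum_left inner_sum_right sum_distrib_left)
  also have "\<dots> = (\<Sum>i\<in>I. \<Sum>j\<in>I. if i = j then (a i)\<^sup>2 else 0)"
    by (intro sum.cong refl) (auto simp: on power2_eq_square)
  finally show ?thesis
    using \<open>finite I\<close> by simp
qed

lemma Bessel_inequality:
  fixes u :: "'i \<Rightarrow> 'a::real_inner"
  assumes "finite I" and on: "\<And>i j. i \<in> I \<Longrightarrow> j \<in> I \<Longrightarrow> u i \<bullet> u j = (if i = j then 1 else 0)"
  shows "(\<Sum>i\<in>I. (x \<bullet> u i)\<^sup>2) \<le> (norm x)\<^sup>2"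
proof -
  let ?p = "\<Sum>i\<in>I. (x \<bullet> u i) *\<^sub>R u i"
  have "0 \<le> (norm (x - ?p))\<^sup>2"
    by simp
  also have "\<dots> = (norm x)\<^sup>2 - 2 * (x \<bullet> ?p) + (norm ?p)\<^sup>2"
    by (simp add: power2_norm_eq_inner inner_diff inner_commute)
  also have "x \<bullet> ?p = (\<Sum>i\<in>I. (x \<bullet> u i)\<^sup>2)"
    by (simp add: inner_sum_right power2_eq_square)
  also have "(norm ?p)\<^sup>2 = (\<Sum>i\<in>I. (x \<bullet> u i)\<^sup>2)"
    by (rule norm_sum_orthonormal[OF assms])
  finally show ?thesis
    by simp
qed

lemma orthonormal_uptoD:
  "orthonormal_upto k u \<Longrightarrow> i \<in> {1..k} \<Longrightarrow> j \<in> {1..k} \<Longrightarrow> u i \<bullet> u j = (if i = j then 1 else 0)"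
  by (auto simp: orthonormal_upto_def)

section \<open>Rank-one matrices and rank\<close>

lemma outer_prod_mult_vec: "outer_prod u v *v x = (v \<bullet> x) *\<^sub>R u"
  by (simp add: outer_prod_def matrix_vector_mult_def vec_eq_iff inner_vec_def sum_distrib_left
      mult_ac)

lemma vec_mult_outer_prod: "x v* outer_prod u v = (x \<bullet> u) *\<^sub>R v"
  by (simp add: outer_prod_def vector_matrix_mult_def vec_eq_iff inner_vec_def sum_distrib_left
      mult_ac)

lemma inner_outer_prod: "X \<bullet> outer_prod u v = (u v* X) \<bullet> v"
proof -
  have "X \<bullet> outer_prod u v = (\<Sum>i\<in>UNIV. \<Sum>j\<in>UNIV. X $ i $ j * (u $ i * v $ j))"
    by (simp add: outer_prod_def inner_vec_def)
  also have "\<dots> = (\<Sum>j\<in>UNIV. \<Sum>i\<in>UNIV. X $ i $ j * (u $ i * v $ j))"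
    by (rule sum.swap)
  also have "\<dots> = (u v* X) \<bullet> v"
    by (simp add: vector_matrix_mult_def inner_vec_def sum_distrib_left mult_ac)
  finally show ?thesis .
qed

lemma inner_outer_prod_outer_prod:
  "outer_prod a b \<bullet> outer_prod u v = (a \<bullet> u) * (b \<bullet> v)"
  by (simp add: inner_outer_prod vec_mult_outer_prod inner_commute)

text \<open>This lets Pythagoras and Bessel in the Frobenius inner product be applied to the
  rank-one terms of a singular value decomposition.\<close>

lemma orthonormal_upto_outer_prod:
  assumes "orthonormal_upto k u" "orthonormal_upto k v"
  shows "orthonormal_upto k (\<lambda>i. outer_prod (u i) (v i))"
  using assms by (auto simp: orthonormal_upto_def inner_outer_prod_outer_prod)

lemma sum_mult_vec:
  fixes A :: "'i \<Rightarrow> real^'n^'m"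
  shows "(\<Sum>i\<in>I. A i) *v x = (\<Sum>i\<in>I. A i *v x)"
  by (induction I rule: infinite_finite_induct) (simp_all add: matrix_vector_mult_add_rdistrib)

lemma vec_mult_sum:
  fixes A :: "'i \<Rightarrow> real^'n^'m"
  shows "x v* (\<Sum>i\<in>I. A i) = (\<Sum>i\<in>I. x v* A i)"
  by (induction I rule: infinite_finite_induct) (simp_all add: vector_matrix_mult_add_rdistrib)

lemma vec_mult_scaleR:
  fixes A :: "real^'n^'m"
  shows "x v* (c *\<^sub>R A) = c *\<^sub>R (x v* A)"
  by (simp add: vector_matrix_mult_def vec_eq_iff sum_distrib_left mult_ac)

lemma sum_outer_prod_mult_vec:
  "(\<Sum>i\<in>I. a i *\<^sub>R outer_prod (u i) (v i)) *v x = (\<Sum>i\<in>I. (a i * (v i \<bullet> x)) *\<^sub>R u i)"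
  by (simp add: sum_mult_vec outer_prod_mult_vec flip: scaleR_matrix_vector_assoc)

lemma vec_mult_sum_outer_prod:
  "x v* (\<Sum>i\<in>I. a i *\<^sub>R outer_prod (u i) (v i)) = (\<Sum>i\<in>I. (a i * (x \<bullet> u i)) *\<^sub>R v i)"
  by (simp add: vec_mult_sum vec_mult_outer_prod vec_mult_scaleR)

lemma rank_le_card:
  fixes A :: "real^'n^'m"
  assumes "\<And>x. A *v x \<in> span S" "finite S"
  shows "rank A \<le> card S"
  unfolding rank_dim_range using assms by (intro dim_le_card) auto

lemma rank_lincomb:
  fixes A B :: "real^'n^'m"
  shows "rank (a *\<^sub>R A + b *\<^sub>R B) \<le> rank A + rank B"
proof -
  let ?R = "\<lambda>A::real^'n^'m. range (\<lambda>x. A *v x)"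
  obtain S where S: "finite S" "card S = rank A" "?R A \<subseteq> span S"
    by (metis basis_exists finiteI_independent rank_dim_range)
  obtain T where T: "finite T" "card T = rank B" "?R B \<subseteq> span T"
    by (metis basis_exists finiteI_independent rank_dim_range)
  have "(a *\<^sub>R A + b *\<^sub>R B) *v x \<in> span (S \<union> T)" for x
  proof -
    have "A *v x \<in> span (S \<union> T)" "B *v x \<in> span (S \<union> T)"
      using S(3) T(3) span_mono[of S "S \<union> T"] span_mono[of T "S \<union> T"] by blast+
    then show ?thesis
      by (simp add: matrix_vector_mult_add_rdistrib span_add span_scale
          flip: scaleR_matrix_vector_assoc)
  qed
  then have "rank (a *\<^sub>R A + b *\<^sub>R B) \<le> card (S \<union> T)"
    using S T by (intro rank_le_card) auto
  also have "\<dots> \<le> rank A + rank B"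
    using card_Un_le[of S T] S T by simp
  finally show ?thesis .
qed

text \<open>Take \<open>C\<close> to be an orthonormal basis of the range of \<open>B\<close>.
  Projecting onto the range leaves \<open>B\<close> unchanged, and the component of
  \<open>B *v x\<close> along \<open>c\<close> is \<open>(c v* B) \<bullet> x\<close>.\<close>

lemma rank_expansion:
  fixes B :: "real^'n^'m"
  obtains C where "finite C" "card C = rank B"
    "\<And>c d. c \<in> C \<Longrightarrow> d \<in> C \<Longrightarrow> c \<bullet> d = (if c = d then 1 else 0)"
    "B = (\<Sum>c\<in>C. outer_prod c (c v* B))"
proof -
  let ?S = "range (\<lambda>x. B *v x)"
  have "subspace ?S"
    by (intro linear_subspace_image subspace_UNIV) simp
  then obtain C where C: "pairwise orthogonal C" "\<And>x. x \<in> C \<Longrightarrow> norm x = 1"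
      "independent C" "card C = dim ?S" "span C = ?S"
    by (metis orthonormal_basis_subspace)
  have fin: "finite C"
    using C(3) by (rule finiteI_independent)
  have "B *v x = (\<Sum>c\<in>C. outer_prod c (c v* B)) *v x" for x
  proof -
    have "B *v x = (\<Sum>c\<in>C. ((B *v x) \<bullet> c) *\<^sub>R c)"
      using orthonormal_basis_expand[OF C(1) C(2) _ fin, of "B *v x"] C(5) by auto
    also have "\<dots> = (\<Sum>c\<in>C. outer_prod c (c v* B)) *v x"
      by (simp add: sum_mult_vec outer_prod_mult_vec dot_lmul_matrix inner_commute[of "B *v x"])
    finally show ?thesis .
  qed
  then have "B = (\<Sum>c\<in>C. outer_prod c (c v* B))"
    by (simp add: matrix_eq)
  moreover have "c \<bullet> d = (if c = d then 1 else 0)" if "c \<in> C" "d \<in> C" for c d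
    using that C(1) C(2)[of c] by (auto simp: pairwise_def orthogonal_def norm_eq_1)
  ultimately show ?thesis
    using that fin C(4) by (simp add: rank_dim_range)
qed

section \<open>Hard and soft thresholding\<close>

text \<open>A fractional knapsack bound: weights in [0, 1] of total at most \<open>r\<close> do best
  on the \<open>r\<close> largest values. Shifting all values by \<open>s r\<close> makes those up
  to \<open>r\<close> nonnegative, where weight 1 is the worst case, and the later ones
  nonpositive.\<close>

lemma weighted_sum_le_initial_sum:
  fixes s t :: "nat \<Rightarrow> real"
  assumes "\<And>i. i \<in> {1..m} \<Longrightarrow> 0 \<le> s i"
    and "\<And>i j. i \<in> {1..m} \<Longrightarrow> j \<in> {1..m} \<Longrightarrow> i \<le> j \<Longrightarrow> s j \<le> s i"
    and "\<And>i. i \<in> {1..m} \<Longrightarrow> 0 \<le> t i" "\<And>i. i \<in> {1..m} \<Longrightarrow> t i \<le> 1"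
    and "(\<Sum>i=1..m. t i) \<le> real r" and r: "1 \<le> r" "r \<le> m"
  shows "(\<Sum>i=1..m. s i * t i) \<le> (\<Sum>i=1..r. s i)"
proof -
  have "(s i - s r) * t i \<le> (if i \<in> {1..r} then s i - s r else 0)" if "i \<in> {1..m}" for i
  proof (cases "i \<le> r")
    case True
    then have "(s i - s r) * t i \<le> (s i - s r) * 1"
      using assms that by (intro mult_left_mono) auto
    then show ?thesis
      using True that by simp
  next
    case False
    then have "s i - s r \<le> 0"
      using assms(2)[of r i] that r by auto
    then show ?thesis
      using False assms(3)[OF that] by (simp add: mult_nonpos_nonneg)
  qed
  then have "(\<Sum>i=1..m. (s i - s r) * t i) \<le> (\<Sum>i=1..m. if i \<in> {1..r} then s i - s r else 0)"
    by (rule sum_mono)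
  also have "\<dots> = (\<Sum>i=1..r. s i - s r)"
    using r by (intro sum.mono_neutral_cong_right) auto
  also have "\<dots> = (\<Sum>i=1..r. s i) - s r * real r"
    by (simp add: sum_subtractf)
  finally have "(\<Sum>i=1..m. s i * t i) \<le> (\<Sum>i=1..r. s i) + s r * ((\<Sum>i=1..m. t i) - real r)"
    by (simp add: algebra_simps sum_subtractf sum_distrib_left sum_distrib_right)
  \<comment> \<open>The shift costs \<open>s r\<close> times the missing weight, which has the right
    sign because \<open>s r\<close> is nonnegative.\<close>
  moreover have "s r * ((\<Sum>i=1..m. t i) - real r) \<le> 0"
    using assms by (intro mult_nonneg_nonpos) auto
  ultimately show ?thesis
    by simp
qed

lemma rank_hard_threshold:
  assumes "hard_threshold r Y W"
  shows "rank W \<le> r"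
proof -
  obtain \<sigma> u v where W: "W = (\<Sum>i=1..r. \<sigma> i *\<^sub>R outer_prod (u i) (v i))"
    using assms by (auto simp: hard_threshold_def)
  have "W *v x \<in> span (u ` {1..r})" for x
    unfolding W sum_outer_prod_mult_vec by (intro span_sum span_scale span_base imageI)
  then have "rank W \<le> card (u ` {1..r})"
    by (intro rank_le_card) auto
  then show ?thesis
    using card_image_le[of "{1..r}" u] by simp
qed

text \<open>Expanding the square, \<open>(norm (Y - B))\<^sup>2\<close> equals
  \<open>(norm Y)\<^sup>2\<close> minus \<open>2 * (Y \<bullet> B) - (norm B)\<^sup>2\<close>. It
  suffices to bound the latter by the sum of the first \<open>r\<close> squared singular values,
  which is exactly what \<open>W\<close> attains.\<close>

theorem Eckart_Young:
  fixes Y W B :: "real^'n^'m"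
  assumes hard: "hard_threshold r Y W" and r: "1 \<le> r" "r \<le> CARD('m)" and B: "rank B \<le> r"
  shows "norm (Y - W) \<le> norm (Y - B)"
proof -
  let ?m = "CARD('m)"
  obtain \<sigma> u v where svd: "is_svd Y \<sigma> u v"
    and W: "W = (\<Sum>i=1..r. \<sigma> i *\<^sub>R outer_prod (u i) (v i))"
    using hard by (auto simp: hard_threshold_def)
  let ?s = "\<Sum>i=1..r. (\<sigma> i)\<^sup>2"
  have u: "orthonormal_upto ?m u" and v: "orthonormal_upto ?m v"
    and Y: "Y = (\<Sum>i=1..?m. \<sigma> i *\<^sub>R outer_prod (u i) (v i))"
    and \<sigma>0: "\<And>i. i \<in> {1..?m} \<Longrightarrow> 0 \<le> \<sigma> i"
    and mono: "\<And>i j. i \<in> {1..?m} \<Longrightarrow> j \<in> {1..?m} \<Longrightarrow> i \<le> j \<Longrightarrow> \<sigma> j \<le> \<sigma> i"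
    using svd by (auto simp: is_svd_def)
  note uv = orthonormal_uptoD[OF orthonormal_upto_outer_prod[OF u v]]
  \<comment> \<open>The discarded tail is orthogonal to \<open>W\<close>, so Pythagoras gives the
    distance from \<open>Y\<close> to \<open>W\<close>.\<close>
  have "Y = W + (\<Sum>i=r+1..?m. \<sigma> i *\<^sub>R outer_prod (u i) (v i))"
    unfolding Y W using r sum.ub_add_nat[of 1 r _ "?m - r"] by simp
  moreover have "W \<bullet> (\<Sum>i=r+1..?m. \<sigma> i *\<^sub>R outer_prod (u i) (v i)) = 0"
    unfolding W inner_sum_left inner_sum_right using r
    by (intro sum.neutral ballI) (auto simp: uv)
  moreover have "(norm W)\<^sup>2 = ?s"
    unfolding W by (rule norm_sum_orthonormal) (use r in \<open>auto simp: uv\<close>)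
  ultimately have YW: "(norm (Y - W))\<^sup>2 = (norm Y)\<^sup>2 - ?s"
    by (simp add: power2_norm_eq_inner inner_add inner_commute)

  obtain C where C: "finite C" "card C = rank B"
    "\<And>c d. c \<in> C \<Longrightarrow> d \<in> C \<Longrightarrow> c \<bullet> d = (if c = d then 1 else 0)"
    "B = (\<Sum>c\<in>C. outer_prod c (c v* B))"
    using rank_expansion[of B] by blast
  let ?t = "\<lambda>i. \<Sum>c\<in>C. (c \<bullet> u i)\<^sup>2"
  have inner_B: "Z \<bullet> B = (\<Sum>c\<in>C. (c v* Z) \<bullet> (c v* B))" for Z
    by (subst C(4)) (simp add: inner_sum_right inner_outer_prod)
  have "2 * (Y \<bullet> B) - (norm B)\<^sup>2
      = (\<Sum>c\<in>C. 2 * ((c v* Y) \<bullet> (c v* B)) - (c v* B) \<bullet> (c v* B))"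
    by (simp add: power2_norm_eq_inner inner_B sum_subtractf sum_distrib_left)
  \<comment> \<open>Complete the square separately for each \<open>c\<close>; this eliminates
    \<open>B\<close> except for the set \<open>C\<close>.\<close>
  also have "\<dots> \<le> (\<Sum>c\<in>C. (norm (c v* Y))\<^sup>2)"
  proof (rule sum_mono)
    fix c
    have "0 \<le> (norm (c v* Y - c v* B))\<^sup>2"
      by simp
    then show "2 * ((c v* Y) \<bullet> (c v* B)) - (c v* B) \<bullet> (c v* B) \<le> (norm (c v* Y))\<^sup>2"
      by (simp add: power2_norm_eq_inner inner_diff inner_commute)
  qed
  also have "\<dots> = (\<Sum>c\<in>C. \<Sum>i=1..?m. (\<sigma> i)\<^sup>2 * (c \<bullet> u i)\<^sup>2)"
    unfolding Y vec_mult_sum_outer_prod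
    by (subst norm_sum_orthonormal) (auto simp: orthonormal_uptoD[OF v] power_mult_distrib)
  also have "\<dots> = (\<Sum>i=1..?m. (\<sigma> i)\<^sup>2 * ?t i)"
    by (subst sum.swap) (simp add: sum_distrib_left)
  also have "\<dots> \<le> ?s"
  \<comment> \<open>Bessel is used twice: for the family \<open>C\<close> it bounds each weight by
    1, and for the family \<open>u\<close> it bounds the total weight by \<open>card C\<close>, the
    rank of \<open>B\<close>.\<close>
  proof (rule weighted_sum_le_initial_sum)
    show "?t i \<le> 1" if "i \<in> {1..?m}" for i
    proof -
      have "?t i \<le> (norm (u i))\<^sup>2"
        using Bessel_inequality[of C "\<lambda>c. c" "u i"] C by (simp add: inner_commute)
      then show ?thesis
        using orthonormal_uptoD[OF u that that] by (simp add: power2_norm_eq_inner)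
    qed
    have "(\<Sum>i=1..?m. ?t i) = (\<Sum>c\<in>C. \<Sum>i=1..?m. (c \<bullet> u i)\<^sup>2)"
      by (rule sum.swap)
    also have "\<dots> \<le> (\<Sum>c\<in>C. (norm c)\<^sup>2)"
      by (intro sum_mono Bessel_inequality) (auto simp: orthonormal_uptoD[OF u])
    also have "\<dots> = (\<Sum>c\<in>C. 1)"
      by (intro sum.cong) (auto simp: power2_norm_eq_inner C(3))
    also have "\<dots> \<le> real r"
      using C(2) B by simp
    finally show "(\<Sum>i=1..?m. ?t i) \<le> real r" .
    show "(\<sigma> j)\<^sup>2 \<le> (\<sigma> i)\<^sup>2" if "i \<in> {1..?m}" "j \<in> {1..?m}" "i \<le> j" for i j
      using mono[OF that] \<sigma>0 that by (intro power_mono) auto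
  qed (use r in \<open>auto intro: sum_nonneg\<close>)
  finally have "(norm (Y - W))\<^sup>2 \<le> (norm Y)\<^sup>2 - (2 * (Y \<bullet> B) - (norm B)\<^sup>2)"
    using YW by simp
  also have "\<dots> = (norm (Y - B))\<^sup>2"
    by (simp add: power2_norm_eq_inner inner_diff inner_commute)
  finally show ?thesis
    by (simp add: abs_le_square_iff[symmetric])
qed

text \<open>The range of \<open>Z\<close> lies in that of \<open>W\<close>: a term survives only if
  \<sigma> exceeds \<nu>, hence is positive, and then \<open>u i\<close> is a multiple of
  \<open>W *v v i\<close>.\<close>

lemma rank_soft_threshold:
  fixes W Z :: "real^'n^'m"
  assumes "soft_threshold \<nu> W Z" and "0 < \<nu>"
  shows "rank Z \<le> rank W"
proof -
  let ?m = "CARD('m)" and ?R = "range (\<lambda>x. W *v x)"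
  obtain \<sigma> u v where svd: "is_svd W \<sigma> u v"
    and Z: "Z = (\<Sum>i=1..?m. max (\<sigma> i - \<nu>) 0 *\<^sub>R outer_prod (u i) (v i))"
    using assms by (auto simp: soft_threshold_def)
  have v: "orthonormal_upto ?m v"
    and W: "W = (\<Sum>i=1..?m. \<sigma> i *\<^sub>R outer_prod (u i) (v i))"
    using svd by (auto simp: is_svd_def)
  have sub: "subspace ?R"
    by (intro linear_subspace_image subspace_UNIV) simp
  have Wv: "W *v v i = \<sigma> i *\<^sub>R u i" if "i \<in> {1..?m}" for i
  proof -
    have "W *v v i = (\<Sum>j=1..?m. if j = i then \<sigma> i *\<^sub>R u i else 0)"
      unfolding W sum_outer_prod_mult_vec
      by (intro sum.cong) (auto simp: orthonormal_uptoD[OF v _ that])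
    then show ?thesis
      using that by simp
  qed
  have "(max (\<sigma> i - \<nu>) 0 * (v i \<bullet> x)) *\<^sub>R u i \<in> ?R" if "i \<in> {1..?m}" for i x
  proof (cases "\<sigma> i \<le> \<nu>")
    case True
    then show ?thesis
      using subspace_0[OF sub] by (simp add: max_def)
  next
    case False
    then have "\<sigma> i \<noteq> 0"
      using \<open>0 < \<nu>\<close> by auto
    then have "u i = (1 / \<sigma> i) *\<^sub>R (W *v v i)"
      by (simp add: Wv[OF that])
    then have "u i \<in> ?R"
      using subspace_scale[OF sub] by (metis rangeI)
    then show ?thesis
      by (rule subspace_scale[OF sub])
  qed
  then have "Z *v x \<in> ?R" for x
    unfolding Z sum_outer_prod_mult_vec by (intro subspace_sum[OF sub])
  then show ?thesis
    unfolding rank_dim_range by (intro dim_subset) auto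
qed

text \<open>Shrinkage moves each of the \<open>CARD('m)\<close> singular values by the minimum of
  \<sigma> and \<nu>, and these changes are the coefficients of an orthonormal expansion.\<close>

lemma norm_diff_soft_threshold:
  fixes W Z :: "real^'n^'m"
  assumes "soft_threshold \<nu> W Z" and "0 \<le> \<nu>"
  shows "norm (W - Z) \<le> sqrt (real CARD('m)) * \<nu>"
proof -
  let ?m = "CARD('m)"
  obtain \<sigma> u v where svd: "is_svd W \<sigma> u v"
    and Z: "Z = (\<Sum>i=1..?m. max (\<sigma> i - \<nu>) 0 *\<^sub>R outer_prod (u i) (v i))"
    using assms by (auto simp: soft_threshold_def)
  have u: "orthonormal_upto ?m u" and v: "orthonormal_upto ?m v"
    and W: "W = (\<Sum>i=1..?m. \<sigma> i *\<^sub>R outer_prod (u i) (v i))"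
    and \<sigma>0: "\<And>i. i \<in> {1..?m} \<Longrightarrow> 0 \<le> \<sigma> i"
    using svd by (auto simp: is_svd_def)
  have WZ: "W - Z = (\<Sum>i=1..?m. (\<sigma> i - max (\<sigma> i - \<nu>) 0) *\<^sub>R outer_prod (u i) (v i))"
    unfolding W Z by (simp add: scaleR_left_diff_distrib sum_subtractf)
  have "(norm (W - Z))\<^sup>2 = (\<Sum>i=1..?m. (\<sigma> i - max (\<sigma> i - \<nu>) 0)\<^sup>2)"
    unfolding WZ
    by (rule norm_sum_orthonormal)
      (auto simp: orthonormal_uptoD[OF orthonormal_upto_outer_prod[OF u v]])
  also have "\<dots> \<le> (\<Sum>i=1..?m. \<nu>\<^sup>2)"
    using \<sigma>0 \<open>0 \<le> \<nu>\<close> by (intro sum_mono power_mono) (auto simp: max_def)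
  also have "\<dots> = (sqrt (real ?m) * \<nu>)\<^sup>2"
    by (simp add: power_mult_distrib)
  finally show ?thesis
    using \<open>0 \<le> \<nu>\<close> by (auto intro: power2_le_imp_le)
qed

section \<open>Restricted isometry\<close>

text \<open>The least constant exists because the admissible ones form a closed set that is nonempty (the
  map is bounded) and bounded below (there is a matrix of norm 1 and rank 1).\<close>

lemma ric_restricted_isometry:
  fixes \<A> :: "real^'n^'m \<Rightarrow> real^'p"
  assumes "linear \<A>" and "1 \<le> s" and "rank X \<le> s"
  shows "\<bar>(norm (\<A> X))\<^sup>2 - (norm X)\<^sup>2\<bar> \<le> ric \<A> s * (norm X)\<^sup>2"
proof -
  define P where "P \<delta> \<longleftrightarrow> (\<forall>X. rank X \<le> s \<longrightarrow>
    (1 - \<delta>) * (norm X)\<^sup>2 \<le> (norm (\<A> X))\<^sup>2 \<and> (norm (\<A> X))\<^sup>2 \<le> (1 + \<delta>) * (norm X)\<^sup>2)" for \<delta> :: real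
  have closed: "closed {\<delta>. P \<delta>}"
    unfolding P_def
    \<comment> \<open>The rank condition does not involve \<delta>, so as a condition on \<delta> it
      is open, as the rule for implications demands.\<close>
    by (intro closed_Collect_all closed_Collect_imp closed_Collect_conj closed_Collect_le
        continuous_intros open_Collect_const)
  obtain M where M: "\<And>X. norm (\<A> X) \<le> M * norm X"
    using linear_bounded[OF \<open>linear \<A>\<close>] by blast
  \<comment> \<open>With this constant the lower estimate has a nonpositive left side, and the upper
    one follows from boundedness.\<close>
  have "P (1 + M\<^sup>2)"
    unfolding P_def
  proof (intro allI impI conjI)
    fix X :: "real^'n^'m"
    show "(1 - (1 + M\<^sup>2)) * (norm X)\<^sup>2 \<le> (norm (\<A> X))\<^sup>2"
      by (rule order_trans[of _ 0]) (auto simp: mult_nonneg_nonneg)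
    have "(norm (\<A> X))\<^sup>2 \<le> M\<^sup>2 * (norm X)\<^sup>2"
      using power_mono[OF M[of X], of 2] by (simp add: power_mult_distrib)
    also have "\<dots> \<le> (1 + (1 + M\<^sup>2)) * (norm X)\<^sup>2"
      by (intro mult_right_mono) auto
    finally show "(norm (\<A> X))\<^sup>2 \<le> (1 + (1 + M\<^sup>2)) * (norm X)\<^sup>2" .
  qed
  moreover have lower: "0 \<le> \<delta>" if "P \<delta>" for \<delta>
  proof -
    \<comment> \<open>A matrix unit at an arbitrary position: having norm 1 and admissible rank, it
      forces 1 - \<delta> \<le> 1 + \<delta>.\<close>
    define E :: "real^'n^'m" where "E = outer_prod (axis undefined 1) (axis undefined 1)"
    have "rank E \<le> card {axis undefined 1 :: real^'m}"
      by (rule rank_le_card) (auto simp: E_def outer_prod_mult_vec span_base span_scale)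
    then have "rank E \<le> s"
      using \<open>1 \<le> s\<close> by simp
    moreover have "(norm E)\<^sup>2 = 1"
      by (simp add: E_def power2_norm_eq_inner inner_outer_prod_outer_prod inner_axis_axis)
    ultimately show ?thesis
      using that unfolding P_def by fastforce
  qed
  ultimately have "Inf {\<delta>. P \<delta>} \<in> {\<delta>. P \<delta>}"
    using closed by (intro closed_contains_Inf bdd_belowI[where m = 0]) auto
  moreover have "Inf {\<delta>. P \<delta>} \<le> \<delta>" if "P \<delta>" for \<delta>
    using that lower by (intro cInf_lower bdd_belowI[where m = 0]) auto
  ultimately have "(LEAST \<delta>. P \<delta>) = Inf {\<delta>. P \<delta>}" "P (Inf {\<delta>. P \<delta>})"
    by (auto intro: Least_equality)
  then have "P (LEAST \<delta>. P \<delta>)"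
    by simp
  then have "P (ric \<A> s)"
    by (simp add: ric_def P_def)
  then show ?thesis
    using \<open>rank X \<le> s\<close> unfolding P_def abs_le_iff by (auto simp: algebra_simps)
qed

text \<open>Polarisation: near-isometry on the plane spanned by \<open>D\<close> and
  \<open>H\<close> carries over to inner products. Normalising both vectors first yields the product
  of the norms instead of a sum of squares.\<close>

lemma restricted_isometry_inner:
  fixes \<A> :: "'a::real_inner \<Rightarrow> 'b::real_inner"
  assumes "linear \<A>"
    and rip: "\<And>s t. \<bar>(norm (\<A> (s *\<^sub>R D + t *\<^sub>R H)))\<^sup>2 - (norm (s *\<^sub>R D + t *\<^sub>R H))\<^sup>2\<bar>
      \<le> \<delta> * (norm (s *\<^sub>R D + t *\<^sub>R H))\<^sup>2"
  shows "\<bar>D \<bullet> H - \<A> D \<bullet> \<A> H\<bar> \<le> \<delta> * norm D * norm H"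
proof (cases "D = 0 \<or> H = 0")
  case True
  then show ?thesis
    using linear_0[OF \<open>linear \<A>\<close>] by auto
next
  case False
  define d h where "d = D /\<^sub>R norm D" and "h = H /\<^sub>R norm H"
  have nd: "d \<bullet> d = 1" "h \<bullet> h = 1"
    using False by (simp_all add: d_def h_def flip: power2_norm_eq_inner)
  have DH: "D = norm D *\<^sub>R d" "H = norm H *\<^sub>R h"
    using False by (simp_all add: d_def h_def)
  have sum: "\<bar>(norm (\<A> d + \<A> h))\<^sup>2 - (norm (d + h))\<^sup>2\<bar> \<le> \<delta> * (norm (d + h))\<^sup>2"
    using rip[of "inverse (norm D)" "inverse (norm H)"]
    by (simp add: d_def h_def linear_add[OF \<open>linear \<A>\<close>])
  have diff: "\<bar>(norm (\<A> d - \<A> h))\<^sup>2 - (norm (d - h))\<^sup>2\<bar> \<le> \<delta> * (norm (d - h))\<^sup>2"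
    using rip[of "inverse (norm D)" "- inverse (norm H)"]
    by (simp add: d_def h_def linear_diff[OF \<open>linear \<A>\<close>])
  have "\<bar>\<A> d \<bullet> \<A> d + \<A> h \<bullet> \<A> h + 2 * (\<A> d \<bullet> \<A> h) - 2 - 2 * (d \<bullet> h)\<bar> \<le> 2 * \<delta> + 2 * (\<delta> * (d \<bullet> h))"
    using sum nd by (simp add: power2_norm_eq_inner inner_add inner_commute algebra_simps)
  moreover have "\<bar>\<A> d \<bullet> \<A> d + \<A> h \<bullet> \<A> h - 2 * (\<A> d \<bullet> \<A> h) - 2 + 2 * (d \<bullet> h)\<bar>
      \<le> 2 * \<delta> - 2 * (\<delta> * (d \<bullet> h))"
    using diff nd by (simp add: power2_norm_eq_inner inner_diff inner_commute algebra_simps)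
  \<comment> \<open>In the difference of the two estimates the squared norms of the images cancel,
    and so do the terms in \<open>\<delta> * (d \<bullet> h)\<close>; a factor 4 remains on both
    sides.\<close>
  ultimately have "\<bar>d \<bullet> h - \<A> d \<bullet> \<A> h\<bar> \<le> \<delta>"
    unfolding abs_le_iff by linarith
  then have "(norm D * norm H) * \<bar>d \<bullet> h - \<A> d \<bullet> \<A> h\<bar> \<le> (norm D * norm H) * \<delta>"
    by (intro mult_left_mono) auto
  moreover have "D \<bullet> H - \<A> D \<bullet> \<A> H = (norm D * norm H) * (d \<bullet> h - \<A> d \<bullet> \<A> h)"
  proof -
    have "\<A> D = norm D *\<^sub>R \<A> d" "\<A> H = norm H *\<^sub>R \<A> h"
      using DH linear_scale[OF \<open>linear \<A>\<close>] by metis+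
    moreover have "D \<bullet> H = norm D * norm H * (d \<bullet> h)"
      by (metis DH inner_scaleR_left inner_scaleR_right mult.assoc)
    ultimately show ?thesis
      by (simp add: right_diff_distrib)
  qed
  ultimately show ?thesis
    by (simp add: abs_mult mult_ac)
qed

section \<open>Convergence of FPCAr\<close>

text \<open>The error estimate for one iteration before shrinkage. The rank bound on
  \<open>X\<close> is what the main proof carries along as an invariant.\<close>

lemma hard_threshold_gradient_step:
  fixes \<A> :: "real^'n^'m \<Rightarrow> real^'p" and X Xr W :: "real^'n^'m"
  assumes "linear \<A>" and "0 \<le> \<delta>"
    and rip: "\<And>Z. rank Z \<le> 3 * r \<Longrightarrow> \<bar>(norm (\<A> Z))\<^sup>2 - (norm Z)\<^sup>2\<bar> \<le> \<delta> * (norm Z)\<^sup>2"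
    and r: "1 \<le> r" "r \<le> CARD('m)" and "rank Xr \<le> r" and "rank X \<le> r"
    and hard: "hard_threshold r (X - adjoint \<A> (\<A> X - (\<A> Xr + e))) W"
  shows "norm (Xr - W) \<le> 2 * \<delta> * norm (Xr - X) + 2 * sqrt (1 + \<delta>) * norm e"
proof -
  define Y where "Y = X - adjoint \<A> (\<A> X - (\<A> Xr + e))"
  define D H where "D = X - Xr" and "H = W - Xr"
  have W: "rank W \<le> r"
    using hard by (rule rank_hard_threshold)
  have rank3: "rank (s *\<^sub>R D + t *\<^sub>R H) \<le> 3 * r" for s t
  proof -
    \<comment> \<open>Both differences share \<open>Xr\<close>, so only three matrices of rank at
      most \<open>r\<close> are involved; this is the source of \<open>3 * r\<close>.\<close>
    have "s *\<^sub>R D + t *\<^sub>R H = 1 *\<^sub>R (s *\<^sub>R X + t *\<^sub>R W) + (- s - t) *\<^sub>R Xr"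
      by (simp add: D_def H_def algebra_simps)
    then have "rank (s *\<^sub>R D + t *\<^sub>R H) \<le> rank (s *\<^sub>R X + t *\<^sub>R W) + rank Xr"
      by (metis rank_lincomb)
    then show ?thesis
      using rank_lincomb[of s X t W] W assms by linarith
  qed
  have "norm (Y - W) \<le> norm (Y - Xr)"
    using Eckart_Young[OF hard r \<open>rank Xr \<le> r\<close>] by (simp add: Y_def)
  then have "(norm (Y - W))\<^sup>2 \<le> (norm (Y - Xr))\<^sup>2"
    by (simp add: power_mono)
  \<comment> \<open>Write \<open>Y - W\<close> as \<open>(Y - Xr) - H\<close> and expand; the square
    of \<open>norm (Y - Xr)\<close> cancels.\<close>
  then have "(norm H)\<^sup>2 \<le> 2 * ((Y - Xr) \<bullet> H)"
    by (simp add: H_def power2_norm_eq_inner inner_diff inner_commute)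
  also have "(Y - Xr) \<bullet> H = (D \<bullet> H - \<A> D \<bullet> \<A> H) + e \<bullet> \<A> H"
  proof -
    have "Y - Xr = D - adjoint \<A> (\<A> D - e)"
      by (simp add: Y_def D_def linear_diff[OF \<open>linear \<A>\<close>] algebra_simps)
    moreover have "adjoint \<A> z \<bullet> H = z \<bullet> \<A> H" for z
      using adjoint_works[OF \<open>linear \<A>\<close>, of H z] by (simp add: inner_commute)
    ultimately show ?thesis
      by (simp add: inner_diff_left)
  qed
  also have "D \<bullet> H - \<A> D \<bullet> \<A> H \<le> \<delta> * norm D * norm H"
    using restricted_isometry_inner[OF \<open>linear \<A>\<close> rip[OF rank3]] by (simp add: abs_le_iff)
  also have "e \<bullet> \<A> H \<le> norm e * (sqrt (1 + \<delta>) * norm H)"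
  proof -
    have "(norm (\<A> H))\<^sup>2 \<le> (sqrt (1 + \<delta>) * norm H)\<^sup>2"
      using rip[of H] rank3[of 0 1] \<open>0 \<le> \<delta>\<close>
      by (simp add: power_mult_distrib abs_le_iff distrib_right)
    then have "norm (\<A> H) \<le> sqrt (1 + \<delta>) * norm H"
      using \<open>0 \<le> \<delta>\<close> by (auto intro: power2_le_imp_le)
    then show ?thesis
      using norm_cauchy_schwarz[of e "\<A> H"] by (meson mult_left_mono norm_ge_zero order_trans)
  qed
  finally have "norm H * norm H \<le> norm H * (2 * \<delta> * norm D + 2 * sqrt (1 + \<delta>) * norm e)"
    by (simp add: power2_eq_square algebra_simps)
  then have "norm H \<le> 2 * \<delta> * norm D + 2 * sqrt (1 + \<delta>) * norm e"
    using \<open>0 \<le> \<delta>\<close> by (cases "H = 0") (auto simp: mult_le_cancel_left_pos)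
  then show ?thesis
    by (simp add: D_def H_def norm_minus_commute)
qed

text \<open>The number \<open>c / (1 - \<alpha>)\<close> is the fixed point of the affine map, so
  this additive term reproduces itself in the induction.\<close>

lemma affine_contraction_iterate:
  fixes d :: "nat \<Rightarrow> real"
  assumes "0 < \<alpha>" "\<alpha> < 1" "0 \<le> c" and step: "\<And>k. k < n \<Longrightarrow> d (Suc k) \<le> \<alpha> * d k + c"
  shows "d n \<le> \<alpha> ^ n * d 0 + c / (1 - \<alpha>)"
  using step
proof (induction n)
  case 0
  then show ?case
    using assms by simp
next
  case (Suc n)
  have "d (Suc n) \<le> \<alpha> * d n + c"
    using Suc.prems by simp
  also have "\<dots> \<le> \<alpha> * (\<alpha> ^ n * d 0 + c / (1 - \<alpha>)) + c"
    using Suc assms by simp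
  also have "\<dots> = \<alpha> ^ Suc n * d 0 + c / (1 - \<alpha>)"
    using \<open>\<alpha> < 1\<close> by (simp add: field_simps)
  finally show ?case .
qed

lemma continuation_schedule_pos:
  assumes "continuation_schedule \<eta> \<mu>bar L \<mu>" and "j \<in> {1..L}"
  shows "0 < \<mu> j"
proof (cases "j = L")
  case True
  then show ?thesis
    using assms by (simp add: continuation_schedule_def)
next
  case False
  then have "j \<in> {1..<L}"
    using assms by auto
  then have "\<mu>bar \<le> \<mu> (Suc j)" "\<mu> (Suc j) < \<mu> j" "0 < \<mu>bar"
    using assms(1) max.cobounded2 unfolding continuation_schedule_def by metis+
  then show ?thesis
    by simp
qed

text \<open>The error \<open>c (j - 1)\<close> added at the end of stage \<open>j - 1\<close> is
  damped by all later stages \<open>j\<close> to \<open>L\<close>, and that of stage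
  \<open>L\<close> by none.\<close>

lemma stages_bound:
  fixes g :: "nat \<Rightarrow> real"
  assumes "0 < \<alpha>" "1 \<le> L" and g1: "g 1 \<le> \<alpha> ^ K 1 * d0 + c 1"
    and step: "\<And>j. j \<in> {1..<L} \<Longrightarrow> g (Suc j) \<le> \<alpha> ^ K (Suc j) * g j + c (Suc j)"
  shows "g L \<le> \<alpha> ^ (\<Sum>j=1..L. K j) * d0 + (\<Sum>j=2..L. \<alpha> ^ (\<Sum>l=j..L. K l) * c (j - 1)) + c L"
  using \<open>1 \<le> L\<close> step
proof (induction L rule: dec_induct)
  case base
  then show ?case
    using g1 by simp
next
  case (step n)
  let ?S = "\<lambda>n. \<Sum>j=2..n. \<alpha> ^ (\<Sum>l=j..n. K l) * c (j - 1)"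
  have "?S (Suc n) = (\<Sum>j=2..n. \<alpha> ^ (\<Sum>l=j..Suc n. K l) * c (j - 1)) + \<alpha> ^ K (Suc n) * c n"
    using \<open>1 \<le> n\<close> by simp
  also have "(\<Sum>j=2..n. \<alpha> ^ (\<Sum>l=j..Suc n. K l) * c (j - 1)) = \<alpha> ^ K (Suc n) * ?S n"
    unfolding sum_distrib_left by (intro sum.cong) (auto simp: power_add)
  \<comment> \<open>A further stage damps every earlier term once more, and the undamped
    \<open>c n\<close> enters the sum as its new last term.\<close>
  finally have S: "?S (Suc n) = \<alpha> ^ K (Suc n) * (?S n + c n)"
    by (simp add: algebra_simps)
  have "g (Suc n) \<le> \<alpha> ^ K (Suc n) * g n + c (Suc n)"
    using step by simp
  also have "\<dots> \<le> \<alpha> ^ K (Suc n) * (\<alpha> ^ (\<Sum>j=1..n. K j) * d0 + ?S n + c n) + c (Suc n)"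
    using step \<open>0 < \<alpha>\<close> by (intro add_right_mono mult_left_mono) auto
  also have "\<dots> = \<alpha> ^ (\<Sum>j=1..Suc n. K j) * d0 + ?S (Suc n) + c (Suc n)"
    unfolding S by (simp add: algebra_simps power_add)
  finally show ?case .
qed

text \<open>The bound on \<open>3 * r\<close> keeps the restricted isometry constant within the
  range where it is defined. The bound on the rank of \<open>X0\<close> starts the invariant that
  every iterate has rank at most \<open>r\<close>, which the first gradient step already
  uses.\<close>

theorem theorem6p1:
  fixes \<A> :: "real^'n^'m \<Rightarrow> real^'p"
    and Xr X0 :: "real^'n^'m"
    and X :: "nat \<Rightarrow> nat \<Rightarrow> real^'n^'m"
    and b e :: "real^'p"
    and r L :: nat
    and K :: "nat \<Rightarrow> nat"
    and \<mu> :: "nat \<Rightarrow> real"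
    and \<alpha> \<beta> \<eta> \<mu>bar :: real
  assumes "CARD('m) \<le> CARD('n)"
    and "linear \<A>"
    and "rank Xr = r"
    and "b = \<A> Xr + e"
    and "1 \<le> r" and "3 * r \<le> CARD('m)"
    and "0 < \<alpha>" and "\<alpha> < 1"
    and "ric \<A> (3 * r) \<le> \<alpha> / sqrt 8"
    and "\<beta> = 2 * sqrt (1 + \<alpha> / sqrt 8)"
    and "rank X0 \<le> r"
    and "continuation_schedule \<eta> \<mu>bar L \<mu>"
    and "FPCAr_run \<A> b r L \<mu> K X0 X"
  shows "norm (Xr - X L (K L))
    \<le> \<alpha> ^ (\<Sum>j=1..L. K j) * norm (Xr - X0)
      + ((\<Sum>j=2..L. \<alpha> ^ (\<Sum>l=j..L. K l)) + 1) * (\<beta> / (1 - \<alpha>)) * norm e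
      + ((\<Sum>j=2..L. \<alpha> ^ (\<Sum>l=j..L. K l) * \<mu> (j - 1)) + \<mu> L)
          * (2 * sqrt (real CARD('m)) / (1 - \<alpha>))"
proof -
  define \<delta> where "\<delta> = \<alpha> / sqrt 8"
  \<comment> \<open>This bounds the contraction factor \<open>2 * \<delta>\<close> of the gradient
    step by \<alpha>.\<close>
  have "2 \<le> sqrt 8"
    by (rule real_le_rsqrt) simp
  then have \<delta>: "0 \<le> \<delta>" "2 * \<delta> \<le> \<alpha>"
    using \<open>0 < \<alpha>\<close> by (auto simp: \<delta>_def field_simps)
  have rip: "\<bar>(norm (\<A> Z))\<^sup>2 - (norm Z)\<^sup>2\<bar> \<le> \<delta> * (norm Z)\<^sup>2" if "rank Z \<le> 3 * r" for Z
  proof -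
    have "\<bar>(norm (\<A> Z))\<^sup>2 - (norm Z)\<^sup>2\<bar> \<le> ric \<A> (3 * r) * (norm Z)\<^sup>2"
      using that assms by (intro ric_restricted_isometry) auto
    also have "\<dots> \<le> \<delta> * (norm Z)\<^sup>2"
      using assms by (intro mult_right_mono) (auto simp: \<delta>_def)
    finally show ?thesis .
  qed
  have run0: "X 1 0 = X0"
    and run: "\<And>j k. j \<in> {1..L} \<Longrightarrow> k < K j \<Longrightarrow> \<exists>W.
        hard_threshold r (X j k - adjoint \<A> (\<A> (X j k) - (\<A> Xr + e))) W \<and>
        soft_threshold (\<mu> j) W (X j (Suc k))"
    and next_stage: "\<And>j. j \<in> {1..<L} \<Longrightarrow> X (Suc j) 0 = X j (K j)"
    using assms(13) \<open>b = \<A> Xr + e\<close> unfolding FPCAr_run_def by blast+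
  note pos = continuation_schedule_pos[OF assms(12)]
  define q where "q = sqrt (real CARD('m))"
  \<comment> \<open>Noise plus shrinkage error per iteration. The factor 2 matches the claimed
    bound; shrinkage itself costs only \<open>q * \<mu> j\<close>, so nonnegativity of that term is
    invoked below.\<close>
  define c where "c j = \<beta> * norm e + 2 * q * \<mu> j" for j
  have q: "0 \<le> q"
    by (simp add: q_def)
  \<comment> \<open>Rank and error go together, since the error estimate for the next iteration
    needs the rank bound for this one.\<close>
  have step: "rank (X j (Suc k)) \<le> r
      \<and> norm (Xr - X j (Suc k)) \<le> \<alpha> * norm (Xr - X j k) + c j"
    if j: "j \<in> {1..L}" and "k < K j" and rk: "rank (X j k) \<le> r" for j k
  proof -
    obtain W where hard: "hard_threshold r (X j k - adjoint \<A> (\<A> (X j k) - (\<A> Xr + e))) W"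
      and soft: "soft_threshold (\<mu> j) W (X j (Suc k))"
      using run[OF j \<open>k < K j\<close>] by blast
    have "norm (Xr - W) \<le> 2 * \<delta> * norm (Xr - X j k) + 2 * sqrt (1 + \<delta>) * norm e"
      by (rule hard_threshold_gradient_step[OF \<open>linear \<A>\<close> \<delta>(1) rip _ _ _ rk hard])
        (use assms in auto)
    also have "\<dots> \<le> \<alpha> * norm (Xr - X j k) + \<beta> * norm e"
      using mult_right_mono[OF \<delta>(2), of "norm (Xr - X j k)"] assms(10) by (simp add: \<delta>_def)
    finally have "norm (Xr - W) \<le> \<alpha> * norm (Xr - X j k) + \<beta> * norm e" .
    moreover have "norm (W - X j (Suc k)) \<le> q * \<mu> j"
      using norm_diff_soft_threshold[OF soft] pos[OF j] by (simp add: q_def)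
    moreover have "0 \<le> q * \<mu> j"
      using q pos[OF j] by simp
    ultimately have "norm (Xr - X j (Suc k)) \<le> \<alpha> * norm (Xr - X j k) + c j"
      using norm_triangle_ineq[of "Xr - W" "W - X j (Suc k)"] by (simp add: c_def)
    then show ?thesis
      using rank_soft_threshold[OF soft pos[OF j]] rank_hard_threshold[OF hard] by simp
  qed
  have rank_inner: "rank (X j k) \<le> r" if "j \<in> {1..L}" "rank (X j 0) \<le> r" "k \<le> K j" for j k
    using that(3)
  proof (induction k)
    case 0
    then show ?case
      using that(2) by simp
  next
    case (Suc k)
    then show ?case
      using step[OF that(1), of k] by simp
  qed
  have rank0: "rank (X j 0) \<le> r" if "1 \<le> j" "j \<le> L" for j
    using that
  proof (induction j rule: dec_induct)
    case base
    then show ?case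
      using run0 \<open>rank X0 \<le> r\<close> by simp
  next
    case (step i)
    then show ?case
      using next_stage[of i] rank_inner[of i "K i"] by simp
  qed
  have stage: "norm (Xr - X j (K j)) \<le> \<alpha> ^ K j * norm (Xr - X j 0) + c j / (1 - \<alpha>)"
    if j: "j \<in> {1..L}" for j
  proof (rule affine_contraction_iterate)
    show "0 \<le> c j"
      using pos[OF j] q \<delta>(1) assms(10) by (auto simp: c_def \<delta>_def)
    show "norm (Xr - X j (Suc k)) \<le> \<alpha> * norm (Xr - X j k) + c j" if "k < K j" for k
      using step[OF j that] rank_inner[OF j rank0, of k] j that by simp
  qed (use \<open>0 < \<alpha>\<close> \<open>\<alpha> < 1\<close> in auto)
  have L: "1 \<le> L"
    using assms(12) by (simp add: continuation_schedule_def)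
  let ?p = "\<lambda>j. \<alpha> ^ (\<Sum>l=j..L. K l)"
  have "norm (Xr - X L (K L)) \<le> \<alpha> ^ (\<Sum>j=1..L. K j) * norm (Xr - X0)
      + (\<Sum>j=2..L. ?p j * (c (j - 1) / (1 - \<alpha>))) + c L / (1 - \<alpha>)"
  \<comment> \<open>Here the quantity followed across stages is the error at the end of each stage,
    which is also the error at the start of the next.\<close>
  proof (rule stages_bound[OF \<open>0 < \<alpha>\<close> L])
    show "norm (Xr - X 1 (K 1)) \<le> \<alpha> ^ K 1 * norm (Xr - X0) + c 1 / (1 - \<alpha>)"
      using stage[of 1] L run0 by simp
    show "norm (Xr - X (Suc j) (K (Suc j)))
        \<le> \<alpha> ^ K (Suc j) * norm (Xr - X j (K j)) + c (Suc j) / (1 - \<alpha>)" if "j \<in> {1..<L}" for j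
      using stage[of "Suc j"] next_stage[OF that] that by simp
  qed
  also have "(\<Sum>j=2..L. ?p j * (c (j - 1) / (1 - \<alpha>)))
      = (\<Sum>j=2..L. ?p j) * (\<beta> / (1 - \<alpha>)) * norm e
        + (\<Sum>j=2..L. ?p j * \<mu> (j - 1)) * (2 * q / (1 - \<alpha>))"
    unfolding sum_distrib_right sum.distrib[symmetric]
    by (intro sum.cong refl) (simp add: c_def add_divide_distrib algebra_simps)
  also have "c L / (1 - \<alpha>) = \<beta> / (1 - \<alpha>) * norm e + \<mu> L * (2 * q / (1 - \<alpha>))"
    by (simp add: c_def add_divide_distrib)
  finally show ?thesis
    by (simp add: q_def algebra_simps)
qed

end
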